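(* Let $M$ be a smooth manifold and $\nabla$ an affine connection on $M$ (possibly with torsion). Let $\tilde h_\pm$ be the Patterson-Walker type $(0,2)$-tensor fields on $T^*M$ determined by $\nabla$, let $\Phi^\nabla:TM\oplus T^*M\to T(T^*M)$ be the bundle morphism $\Phi^\nabla(X+\alpha)=X^H+\alpha^V$, and let $\tilde{\tilde h}_\pm(\sigma,\tau)=\tilde h_\pm(\Phi^\nabla(\sigma),\Phi^\nabla(\tau))$ be the pull-back tensors on $TM\oplus T^*M$. Then $$\tilde{\tilde h}_+=-2\langle\cdot,\cdot\rangle,\qquad \tilde{\tilde h}_-=-2(\cdot,\cdot),$$ where $\langle X+\alpha,Y+\beta\rangle=-\frac12(\alpha(Y)+\beta(X))$ and $(X+\alpha,Y+\beta)=-\frac12(\alpha(Y)-\beta(X))$.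
   Context: Let $\pi:T^*M\to M$ be the projection, with local coordinates $(\tilde x^i,y_i)$ on $T^*M$ induced by coordinates $(x^i)$ on $M$, and Christoffel symbols $\nabla_{\partial/\partial x^i}\partial/\partial x^j=\Gamma^k_{ij}\partial/\partial x^k$. The horizontal lift of a vector field $X=X^i\partial/\partial x^i$ is $X^H=X^i\big(\partial/\partial\tilde x^i+y_k\Gamma^k_{il}\,\partial/\partial y_l\big)$; the vertical lift of a 1-form $\alpha=\alpha_i dx^i$ is $\alpha^V=\alpha_i\,\partial/\partial y_i$ (i.e. the standard identification of $T^*_{\pi(a)}M$ with its tangent space at $a$). At each $a\in T^*M$, $\Phi^\nabla$ maps $T_{\pi(a)}M\oplus T^*_{\pi(a)}M$ isomorphically onto $T_a(T^*M)$, $X+\alpha\mapsto X^H_a+\alpha^V_a$. The tensors $\tilde h_\pm$ on $T^*M$ are defined by $\tilde h_\pm(X^H,Y^H)=0$, $\tilde h_\pm(\alpha^V,\beta^V)=0$, $\tilde h_\pm(\alpha^V,X^H)=\alpha(X)$, $\tilde h_\pm(X^H,\alpha^V)=\pm\alpha(X)$ for vector fields $X,Y$ and 1-forms $\alpha,\beta$ on $M$. *)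

theory Defs
  imports "HOL-Analysis.Analysis"
begin

section \<open>Smooth functions between Euclidean spaces\<close>

text \<open>Only meaningful for open sets \<open>S\<close>.\<close>

primrec Ck_on ::
  "nat \<Rightarrow> ('e::euclidean_space \<Rightarrow> 'f::real_normed_vector) \<Rightarrow> 'e set \<Rightarrow> bool" where
  "Ck_on 0 f S \<longleftrightarrow> continuous_on S f"
| "Ck_on (Suc k) f S \<longleftrightarrow> (\<forall>x\<in>S. f differentiable (at x)) \<and>
     (\<forall>v. Ck_on k (\<lambda>x. frechet_derivative f (at x) v) S)"

definition smooth_on ::
  "('e::euclidean_space \<Rightarrow> 'f::real_normed_vector) \<Rightarrow> 'e set \<Rightarrow> bool" where
  "smooth_on f S \<longleftrightarrow> (\<forall>k. Ck_on k f S)"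

section \<open>Charts, smooth manifolds, tangent vectors\<close>

text \<open>A chart is a pair \<open>(U, \<phi>)\<close>; the values of \<open>\<phi>\<close> outside \<open>U\<close> are irrelevant.\<close>

type_synonym ('a, 'e) chart = "'a set \<times> ('a \<Rightarrow> 'e)"

definition chart_inv :: "('a, 'e) chart \<Rightarrow> 'e \<Rightarrow> 'a" where
  "chart_inv c = inv_into (fst c) (snd c)"

definition transition :: "('a, 'e) chart \<Rightarrow> ('a, 'e) chart \<Rightarrow> 'e \<Rightarrow> 'e" where
  "transition c d = snd d \<circ> chart_inv c"

definition carrier_of :: "('a, 'e) chart set \<Rightarrow> 'a set" where
  "carrier_of A = (\<Union>c\<in>A. fst c)"

text \<open>The atlas \<open>A\<close> is not required to be maximal: it generates the smooth structure.\<close>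

definition smooth_manifold ::
  "'a topology \<Rightarrow> ('a, 'e::euclidean_space) chart set \<Rightarrow> bool" where
  "smooth_manifold X A \<longleftrightarrow>
     Hausdorff_space X \<and> second_countable X \<and> carrier_of A = topspace X \<and>
     (\<forall>c\<in>A. openin X (fst c) \<and> open (snd c ` fst c) \<and>
        homeomorphic_map (subtopology X (fst c)) (top_of_set (snd c ` fst c)) (snd c)) \<and>
     (\<forall>c\<in>A. \<forall>d\<in>A. smooth_on (transition c d) (snd c ` (fst c \<inter> fst d)))"

text \<open>A tangent vector at \<open>p\<close> assigns to each chart around \<open>p\<close> its component vector in that
  chart, the components being related by the derivatives of the transition maps. The value \<open>0\<close>
  on all other arguments makes the representation unique.\<close>

type_synonym ('a, 'e) tvec = "('a, 'e) chart \<Rightarrow> 'e"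

definition tangent_space ::
  "('a, 'e::euclidean_space) chart set \<Rightarrow> 'a \<Rightarrow> ('a, 'e) tvec set" where
  "tangent_space A p = {v.
     (\<forall>c. \<not> (c \<in> A \<and> p \<in> fst c) \<longrightarrow> v c = 0) \<and>
     (\<forall>c\<in>A. \<forall>d\<in>A. p \<in> fst c \<inter> fst d \<longrightarrow>
        v d = frechet_derivative (transition c d) (at (snd c p)) (v c))}"

definition tv_add ::
  "('a, 'e::euclidean_space) tvec \<Rightarrow> ('a, 'e) tvec \<Rightarrow> ('a, 'e) tvec" where
  "tv_add v w = (\<lambda>c. v c + w c)"

definition tv_scale ::
  "real \<Rightarrow> ('a, 'e::euclidean_space) tvec \<Rightarrow> ('a, 'e) tvec" where
  "tv_scale r v = (\<lambda>c. r *\<^sub>R v c)"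

text \<open>The tangent vector at \<open>p\<close> with components \<open>x\<close> in the chart \<open>c\<close>; in particular
  \<open>tangent_vec A c p (axis i 1)\<close> is the coordinate vector \<open>\<partial>/\<partial>x\<^sup>i\<close> at \<open>p\<close>.\<close>

definition tangent_vec ::
  "('a, 'e::euclidean_space) chart set \<Rightarrow> ('a, 'e) chart \<Rightarrow> 'a \<Rightarrow> 'e \<Rightarrow> ('a, 'e) tvec" where
  "tangent_vec A c p x = (\<lambda>d. if d \<in> A \<and> p \<in> fst d
     then frechet_derivative (transition c d) (at (snd c p)) x else 0)"

text \<open>A chosen chart around \<open>p\<close>, for evaluating chart-independent expressions.\<close>

definition chart_at :: "('a, 'e) chart set \<Rightarrow> 'a \<Rightarrow> ('a, 'e) chart" where
  "chart_at A p = (SOME c. c \<in> A \<and> p \<in> fst c)"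

type_synonym ('a, 'e) covec = "('a, 'e) tvec \<Rightarrow> real"

text \<open>A covector is a linear functional on the tangent space; it is set to \<open>0\<close> elsewhere, so that
  it is determined by its values on tangent vectors.\<close>

definition cotangent_space ::
  "('a, 'e::euclidean_space) chart set \<Rightarrow> 'a \<Rightarrow> ('a, 'e) covec set" where
  "cotangent_space A p = {\<omega>.
     (\<forall>v. v \<notin> tangent_space A p \<longrightarrow> \<omega> v = 0) \<and>
     (\<forall>v\<in>tangent_space A p. \<forall>w\<in>tangent_space A p. \<omega> (tv_add v w) = \<omega> v + \<omega> w) \<and>
     (\<forall>r. \<forall>v\<in>tangent_space A p. \<omega> (tv_scale r v) = r * \<omega> v)}"

section \<open>Smooth functions and tensor fields on a manifold\<close>

text \<open>Fields are functions on the whole type, of which only the values on the manifold matter.\<close>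

definition smooth_fun ::
  "('a, 'e::euclidean_space) chart set \<Rightarrow> ('a \<Rightarrow> real) \<Rightarrow> bool" where
  "smooth_fun A f \<longleftrightarrow> (\<forall>c\<in>A. smooth_on (f \<circ> chart_inv c) (snd c ` fst c))"

definition vector_field ::
  "('a, 'e::euclidean_space) chart set \<Rightarrow> ('a \<Rightarrow> ('a, 'e) tvec) \<Rightarrow> bool" where
  "vector_field A V \<longleftrightarrow>
     (\<forall>p\<in>carrier_of A. V p \<in> tangent_space A p) \<and>
     (\<forall>c\<in>A. smooth_on (\<lambda>z. V (chart_inv c z) c) (snd c ` fst c))"

definition one_form ::
  "('a, 'e::euclidean_space) chart set \<Rightarrow> ('a \<Rightarrow> ('a, 'e) covec) \<Rightarrow> bool" where
  "one_form A \<alpha> \<longleftrightarrow>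
     (\<forall>p\<in>carrier_of A. \<alpha> p \<in> cotangent_space A p) \<and>
     (\<forall>c\<in>A. \<forall>b\<in>Basis.
        smooth_on (\<lambda>z. \<alpha> (chart_inv c z) (tangent_vec A c (chart_inv c z) b)) (snd c ` fst c))"

definition tensor_field_02 ::
  "('a, 'e::euclidean_space) chart set
     \<Rightarrow> ('a \<Rightarrow> ('a, 'e) tvec \<Rightarrow> ('a, 'e) tvec \<Rightarrow> real) \<Rightarrow> bool" where
  "tensor_field_02 A h \<longleftrightarrow>
     (\<forall>p\<in>carrier_of A. \<forall>u\<in>tangent_space A p. \<forall>v\<in>tangent_space A p. \<forall>w\<in>tangent_space A p. \<forall>r.
        h p (tv_add u v) w = h p u w + h p v w \<and>
        h p u (tv_add v w) = h p u v + h p u w \<and>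
        h p (tv_scale r u) v = r * h p u v \<and>
        h p u (tv_scale r v) = r * h p u v) \<and>
     (\<forall>c\<in>A. \<forall>b\<in>Basis. \<forall>b'\<in>Basis.
        smooth_on (\<lambda>z. let p = chart_inv c z in h p (tangent_vec A c p b) (tangent_vec A c p b'))
          (snd c ` fst c))"

section \<open>Affine connections\<close>

definition dir_deriv ::
  "('a, 'e::euclidean_space) chart set \<Rightarrow> 'a \<Rightarrow> ('a, 'e) tvec \<Rightarrow> ('a \<Rightarrow> real) \<Rightarrow> real" where
  "dir_deriv A p v f = (let c = chart_at A p in
     frechet_derivative (f \<circ> chart_inv c) (at (snd c p)) (v c))"

type_synonym ('a, 'e) conn =
  "('a \<Rightarrow> ('a, 'e) tvec) \<Rightarrow> ('a \<Rightarrow> ('a, 'e) tvec) \<Rightarrow> 'a \<Rightarrow> ('a, 'e) tvec"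

text \<open>A Koszul connection on the tangent bundle; torsion is not restricted.\<close>

definition affine_connection ::
  "('a, 'e::euclidean_space) chart set \<Rightarrow> ('a, 'e) conn \<Rightarrow> bool" where
  "affine_connection A nabla \<longleftrightarrow>
     (\<forall>V W. vector_field A V \<longrightarrow> vector_field A W \<longrightarrow> vector_field A (nabla V W)) \<and>
     (\<forall>V V' W f. vector_field A V \<longrightarrow> vector_field A V' \<longrightarrow> vector_field A W \<longrightarrow> smooth_fun A f \<longrightarrow>
        (\<forall>p\<in>carrier_of A.
           nabla (\<lambda>q. tv_add (V q) (V' q)) W p = tv_add (nabla V W p) (nabla V' W p) \<and>
           nabla (\<lambda>q. tv_scale (f q) (V q)) W p = tv_scale (f p) (nabla V W p) \<and>
           nabla W (\<lambda>q. tv_add (V q) (V' q)) p = tv_add (nabla W V p) (nabla W V' p) \<and>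
           nabla W (\<lambda>q. tv_scale (f q) (V q)) p =
             tv_add (tv_scale (dir_deriv A p (W p) f) (V p)) (tv_scale (f p) (nabla W V p))))"

text \<open>\<open>christoffel X A nabla c p i j $ k\<close> is the symbol \<open>\<Gamma>\<^sup>k\<^sub>i\<^sub>j\<close> at \<open>p\<close> in the chart \<open>c\<close>. As \<open>nabla\<close> acts on
  global vector fields, the local fields \<open>\<partial>/\<partial>x\<^sup>i\<close> and \<open>\<partial>/\<partial>x\<^sup>j\<close> are replaced by global fields that
  agree with them near \<open>p\<close>; by locality the result does not depend on the extensions.\<close>

definition christoffel ::
  "'a topology \<Rightarrow> ('a, real^'n) chart set \<Rightarrow> ('a, real^'n) conn
     \<Rightarrow> ('a, real^'n) chart \<Rightarrow> 'a \<Rightarrow> 'n::finite \<Rightarrow> 'n \<Rightarrow> real^'n" where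
  "christoffel X A nabla c p i j = (THE g. \<forall>V W.
     vector_field A V \<and> vector_field A W \<and>
     (\<exists>N. openin X N \<and> p \<in> N \<and> N \<subseteq> fst c \<and>
        (\<forall>q\<in>N. V q = tangent_vec A c q (axis i 1) \<and> W q = tangent_vec A c q (axis j 1)))
     \<longrightarrow> nabla V W p = tangent_vec A c p g)"

section \<open>The cotangent bundle\<close>

type_synonym ('a, 'n) cot = "'a \<times> ('a, real^'n) covec"

text \<open>The chart \<open>(x\<^sup>i)\<close> on \<open>U\<close> induces on the preimage of \<open>U\<close> the coordinates \<open>(x\<^sup>i, y\<^sub>i)\<close> with
  \<open>y\<^sub>i (p, \<omega>) = \<omega> (\<partial>/\<partial>x\<^sup>i)\<close>. The topology of the cotangent bundle is the one given by these charts.\<close>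

definition cot_chart ::
  "('a, real^'n) chart set \<Rightarrow> ('a, real^'n) chart
     \<Rightarrow> (('a, 'n::finite) cot, (real^'n) \<times> (real^'n)) chart" where
  "cot_chart A c =
     (SIGMA p:fst c. cotangent_space A p,
      \<lambda>(p, \<omega>). (snd c p, \<chi> i. \<omega> (tangent_vec A c p (axis i 1))))"

definition cot_atlas ::
  "('a, real^'n) chart set \<Rightarrow> (('a, 'n::finite) cot, (real^'n) \<times> (real^'n)) chart set" where
  "cot_atlas A = cot_chart A ` A"

definition cotangent_bundle :: "('a, real^'n) chart set \<Rightarrow> ('a, 'n::finite) cot set" where
  "cotangent_bundle A = (SIGMA p:carrier_of A. cotangent_space A p)"

section \<open>Lifts to the cotangent bundle\<close>

text \<open>\<open>X\<^sup>H = X\<^sup>i (\<partial>/\<partial>x\<^sup>i + y\<^sub>k \<Gamma>\<^sup>k\<^sub>i\<^sub>l \<partial>/\<partial>y\<^sub>l)\<close> and \<open>\<alpha>\<^sup>V = \<alpha>\<^sub>i \<partial>/\<partial>y\<^sub>i\<close> at \<open>a\<close>. Both expressions depend only on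
  the values of \<open>X\<close> and \<open>\<alpha>\<close> at the base point of \<open>a\<close>, and not on the chart.\<close>

definition horizontal_lift ::
  "'a topology \<Rightarrow> ('a, real^'n) chart set \<Rightarrow> ('a, real^'n) conn \<Rightarrow> ('a, 'n::finite) cot
     \<Rightarrow> ('a, real^'n) tvec \<Rightarrow> (('a, 'n) cot, (real^'n) \<times> (real^'n)) tvec" where
  "horizontal_lift X A nabla a v =
     (let c = chart_at A (fst a); y = snd (snd (cot_chart A c) a) in
      tangent_vec (cot_atlas A) (cot_chart A c) a
        (v c, \<chi> l. \<Sum>i\<in>UNIV. \<Sum>k\<in>UNIV. v c $ i * y $ k * christoffel X A nabla c (fst a) i l $ k))"

definition vertical_lift ::
  "('a, real^'n) chart set \<Rightarrow> ('a, 'n::finite) cot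
     \<Rightarrow> ('a, real^'n) covec \<Rightarrow> (('a, 'n) cot, (real^'n) \<times> (real^'n)) tvec" where
  "vertical_lift A a \<alpha> =
     (let c = chart_at A (fst a) in
      tangent_vec (cot_atlas A) (cot_chart A c) a
        (0, \<chi> i. \<alpha> (tangent_vec A c (fst a) (axis i 1))))"

definition Phi ::
  "'a topology \<Rightarrow> ('a, real^'n) chart set \<Rightarrow> ('a, real^'n) conn \<Rightarrow> ('a, 'n::finite) cot
     \<Rightarrow> ('a, real^'n) tvec \<times> ('a, real^'n) covec \<Rightarrow> (('a, 'n) cot, (real^'n) \<times> (real^'n)) tvec" where
  "Phi X A nabla a \<sigma> = tv_add (horizontal_lift X A nabla a (fst \<sigma>)) (vertical_lift A a (snd \<sigma>))"

section \<open>Patterson-Walker tensors and their pull-backs\<close>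

type_synonym ('a, 'n) cot_tensor =
  "('a, 'n) cot \<Rightarrow> (('a, 'n) cot, (real^'n) \<times> (real^'n)) tvec
     \<Rightarrow> (('a, 'n) cot, (real^'n) \<times> (real^'n)) tvec \<Rightarrow> real"

text \<open>The sign \<open>s\<close> is \<open>1\<close> or \<open>-1\<close>. Since every tangent vector of the cotangent bundle is a horizontal
  plus a vertical lift, at most one tensor field satisfies these equations, up to its values off
  the tangent spaces.\<close>

definition patterson_walker ::
  "'a topology \<Rightarrow> ('a, real^'n) chart set \<Rightarrow> ('a, real^'n) conn \<Rightarrow> real
     \<Rightarrow> ('a, 'n::finite) cot_tensor \<Rightarrow> bool" where
  "patterson_walker X A nabla s h \<longleftrightarrow>
     tensor_field_02 (cot_atlas A) h \<and>
     (\<forall>V W \<alpha> \<beta>. vector_field A V \<longrightarrow> vector_field A W \<longrightarrow> one_form A \<alpha> \<longrightarrow> one_form A \<beta> \<longrightarrow>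
        (\<forall>a\<in>cotangent_bundle A. let p = fst a;
            H = horizontal_lift X A nabla a; L = vertical_lift A a in
           h a (H (V p)) (H (W p)) = 0 \<and>
           h a (L (\<alpha> p)) (L (\<beta> p)) = 0 \<and>
           h a (L (\<alpha> p)) (H (V p)) = \<alpha> p (V p) \<and>
           h a (H (V p)) (L (\<alpha> p)) = s * \<alpha> p (V p)))"

definition pull_back ::
  "'a topology \<Rightarrow> ('a, real^'n) chart set \<Rightarrow> ('a, real^'n) conn \<Rightarrow> ('a, 'n::finite) cot_tensor
     \<Rightarrow> ('a, 'n) cot \<Rightarrow> ('a, real^'n) tvec \<times> ('a, real^'n) covec
     \<Rightarrow> ('a, real^'n) tvec \<times> ('a, real^'n) covec \<Rightarrow> real" where
  "pull_back X A nabla h a \<sigma> \<tau> = h a (Phi X A nabla a \<sigma>) (Phi X A nabla a \<tau>)"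

definition sym_pairing ::
  "('a, 'e) tvec \<times> ('a, 'e) covec \<Rightarrow> ('a, 'e) tvec \<times> ('a, 'e) covec \<Rightarrow> real" where
  "sym_pairing = (\<lambda>(v, \<alpha>) (w, \<beta>). - (1/2) * (\<alpha> w + \<beta> v))"

definition skew_pairing ::
  "('a, 'e) tvec \<times> ('a, 'e) covec \<Rightarrow> ('a, 'e) tvec \<times> ('a, 'e) covec \<Rightarrow> real" where
  "skew_pairing = (\<lambda>(v, \<alpha>) (w, \<beta>). - (1/2) * (\<alpha> w - \<beta> v))"

end

theory Submission
  imports Defs
begin

text \<open>By bilinearity the pull-back at \<open>a\<close> of \<open>(X + \<alpha>, Y + \<beta>)\<close> is the sum of the four values of the
  tensor on pairs of lifts, namely \<open>0\<close>, \<open>0\<close>, \<open>\<alpha> Y\<close> and \<open>\<plusminus> \<beta> X\<close>. Two points need an argument. The values are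
  prescribed only for lifts of global fields, so tangent vectors and covectors at a point have to be
  extended to the manifold by means of bump functions. And bilinearity holds only on
  tangent vectors, so the lifts have to satisfy the transformation law between the induced charts of
  the cotangent bundle; this is the chain rule, for transition maps that involve the Jacobians of those
  of the base.\<close>

section \<open>Calculus of smooth functions\<close>

lemma differentiable_transform_open:
  assumes "f differentiable (at x)" "open S" "x \<in> S" "\<And>x. x \<in> S \<Longrightarrow> f x = g x"
  shows "g differentiable (at x)"
  using assms unfolding differentiable_def
  by (meson has_derivative_transform_within_open)

lemma Ck_on_cong:
  assumes "open S" "\<And>x. x \<in> S \<Longrightarrow> f x = g x" "Ck_on k f S"
  shows "Ck_on k g S"
  using assms(2,3)
proof (induction k arbitrary: f g)
  case 0 then show ?case by (simp cong: continuous_on_cong)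
next
  case (Suc k)
  have "g differentiable (at x)" if "x \<in> S" for x
    using differentiable_transform_open[of f x S g] Suc.prems that assms(1) by simp
  moreover have "Ck_on k (\<lambda>x. frechet_derivative g (at x) v) S" for v
  proof (rule Suc.IH)
    show "Ck_on k (\<lambda>x. frechet_derivative f (at x) v) S" using Suc.prems by simp
    show "frechet_derivative f (at x) v = frechet_derivative g (at x) v" if "x \<in> S" for x
      using frechet_derivative_transform_within_open[of f x S g] Suc.prems that assms(1) by simp
  qed
  ultimately show ?case by simp
qed

text \<open>Uniqueness of the derivative identifies the chosen \<open>frechet_derivative\<close>
  with an explicit formula \<open>f'\<close> on \<open>S\<close>, and \<open>Ck_on_cong\<close>
  carries this to higher orders. The closure rules below use it to work with explicit
  derivatives.\<close>

lemma Ck_on_SucI: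
  assumes "open S" "\<And>x. x \<in> S \<Longrightarrow> (f has_derivative f' x) (at x)"
    "\<And>v. Ck_on k (\<lambda>x. f' x v) S"
  shows "Ck_on (Suc k) f S"
proof -
  have *: "f' x = frechet_derivative f (at x)" if "x \<in> S" for x
    using assms(2)[OF that] by (rule frechet_derivative_at)
  have "Ck_on k (\<lambda>x. frechet_derivative f (at x) v) S" for v
    by (rule Ck_on_cong[OF assms(1) _ assms(3)[of v]]) (simp add: *)
  then show ?thesis using assms(2) by (auto simp: differentiable_def)
qed

lemma Ck_on_has_derivative:
  "Ck_on (Suc k) f S \<Longrightarrow> x \<in> S \<Longrightarrow> (f has_derivative frechet_derivative f (at x)) (at x)"
  by (simp add: frechet_derivative_works)

text \<open>The recursion mentions continuity only at order \<open>0\<close>, so the base case has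
  to recover it from differentiability. Product and chain rule rely on this lemma, since the
  undifferentiated functions reappear in their derivatives.\<close>

lemma Ck_on_SucD: "Ck_on (Suc k) f S \<Longrightarrow> Ck_on k f S"
proof (induction k arbitrary: f)
  case 0
  then show ?case
    by (auto intro!: continuous_at_imp_continuous_on differentiable_imp_continuous_within)
next
  case (Suc k)
  then have "Ck_on k (\<lambda>x. frechet_derivative f (at x) v) S" for v
    by (intro Suc.IH) (simp del: Ck_on.simps add: Ck_on.simps(2)[of "Suc k" f])
  with Suc.prems show ?case by simp
qed

lemma Ck_on_Un:
  assumes "open S" "open T" "Ck_on k f S" "Ck_on k f T"
  shows "Ck_on k f (S \<union> T)"
  using assms(3,4)
proof (induction k arbitrary: f)
  case 0 with assms(1,2) show ?case by (simp add: continuous_on_open_Un)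
qed auto

lemma Ck_on_const: "open S \<Longrightarrow> Ck_on k (\<lambda>x. c) S"
proof (induction k arbitrary: c)
  case (Suc k) then show ?case by (intro Ck_on_SucI[OF _ has_derivative_const])
qed simp

lemma Ck_on_linear:
  assumes "open S" "bounded_linear L" "Ck_on k f S"
  shows "Ck_on k (\<lambda>x. L (f x)) S"
  using assms(3)
proof (induction k arbitrary: f)
  case 0 then show ?case using assms(2) by (simp add: bounded_linear.continuous_on)
next
  case (Suc k)
  show ?case
    by (rule Ck_on_SucI[OF assms(1)
          bounded_linear.has_derivative[OF assms(2) Ck_on_has_derivative[OF Suc.prems]]])
      (use Suc in simp_all)
qed

lemma Ck_on_ident: "open S \<Longrightarrow> Ck_on k (\<lambda>x. x) S"
proof (cases k)
  case (Suc j)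
  assume "open S"
  then show ?thesis
    unfolding Suc by (intro Ck_on_SucI[OF _ has_derivative_ident] Ck_on_const)
qed simp

lemma Ck_on_add:
  assumes "open S" "Ck_on k f S" "Ck_on k g S"
  shows "Ck_on k (\<lambda>x. f x + g x) S"
  using assms(2,3)
proof (induction k arbitrary: f g)
  case 0 then show ?case by (simp add: continuous_on_add)
next
  case (Suc k)
  show ?case
    by (rule Ck_on_SucI[OF assms(1) has_derivative_add[OF
            Ck_on_has_derivative[OF Suc.prems(1)] Ck_on_has_derivative[OF Suc.prems(2)]]])
      (use Suc in simp_all)
qed

lemma Ck_on_sum:
  assumes "open S" "finite I" "\<And>i. i \<in> I \<Longrightarrow> Ck_on k (f i) S"
  shows "Ck_on k (\<lambda>x. \<Sum>i\<in>I. f i x) S"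
  using assms(2,3)
proof (induction I)
  case empty then show ?case using assms(1) by (simp add: Ck_on_const)
next
  case (insert i I) then show ?case using assms(1) by (simp add: Ck_on_add)
qed

text \<open>By the Leibniz rule the derivative is a sum of two expressions of the same shape, so the
  induction runs over all \<open>f\<close> and \<open>g\<close> at once.\<close>

lemma Ck_on_bilinear:
  assumes "open S" "bounded_bilinear B" "Ck_on k f S" "Ck_on k g S"
  shows "Ck_on k (\<lambda>x. B (f x) (g x)) S"
  using assms(3,4)
proof (induction k arbitrary: f g)
  case 0 then show ?case using assms(2) by (simp add: bounded_bilinear.continuous_on)
next
  case (Suc k)
  note D = bounded_bilinear.FDERIV[OF assms(2)
      Ck_on_has_derivative[OF Suc.prems(1)] Ck_on_has_derivative[OF Suc.prems(2)]]
  show ?case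
  proof (rule Ck_on_SucI[OF assms(1) D])
    fix v
    have "Ck_on k f S" "Ck_on k g S"
      using Suc.prems by (blast intro: Ck_on_SucD)+
    then show "Ck_on k (\<lambda>x. B (f x) (frechet_derivative g (at x) v)
        + B (frechet_derivative f (at x) v) (g x)) S"
      using Suc.prems by (intro Ck_on_add Suc.IH assms(1)) simp_all
  qed
qed

lemma Ck_on_compose:
  fixes f :: "'d::euclidean_space \<Rightarrow> 'e::euclidean_space"
    and g :: "'e \<Rightarrow> 'f::real_normed_vector"
  assumes "open S" "f ` S \<subseteq> T" "Ck_on k f S" "Ck_on k g T"
  shows "Ck_on k (\<lambda>x. g (f x)) S"
  using assms(3,4)
proof (induction k arbitrary: g)
  case 0 then show ?case
    using assms(2) by (auto intro: continuous_on_compose2[of T g S f])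
next
  case (Suc k)
  let ?f = "\<lambda>x. frechet_derivative f (at x)" and ?g = "\<lambda>y. frechet_derivative g (at y)"
  show ?case
  proof (rule Ck_on_SucI[OF assms(1)])
    fix x assume x: "x \<in> S"
    have lin: "linear (?g (f x))"
      using Suc.prems(2) x assms(2) by (auto intro!: linear_frechet_derivative)
    have "f x \<in> T" using x assms(2) by blast
    then have D: "((\<lambda>x. g (f x)) has_derivative (\<lambda>v. ?g (f x) (?f x v))) (at x)"
      using has_derivative_compose[OF Ck_on_has_derivative[OF Suc.prems(1) x]
          Ck_on_has_derivative[OF Suc.prems(2)]] by simp
    \<comment> \<open>\<open>Ck_on\<close> constrains only derivatives in a fixed direction, whereas
      the direction \<open>?f x v\<close> moves with \<open>x\<close>. Expanding it in the basis
      leaves fixed directions \<open>b\<close> with coefficients that are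
      \<open>Ck_on k\<close>.\<close>
    have eq: "(\<lambda>v. ?g (f x) (?f x v)) = (\<lambda>v. \<Sum>b\<in>Basis. (?f x v \<bullet> b) *\<^sub>R ?g (f x) b)"
    proof
      fix v
      have "?g (f x) (?f x v) = ?g (f x) (\<Sum>b\<in>Basis. (?f x v \<bullet> b) *\<^sub>R b)"
        by (simp add: euclidean_representation)
      then show "?g (f x) (?f x v) = (\<Sum>b\<in>Basis. (?f x v \<bullet> b) *\<^sub>R ?g (f x) b)"
        by (simp add: linear_sum[OF lin] linear_scale[OF lin])
    qed
    show "((\<lambda>x. g (f x)) has_derivative (\<lambda>v. \<Sum>b\<in>Basis. (?f x v \<bullet> b) *\<^sub>R ?g (f x) b)) (at x)"
      using D unfolding eq .
  next
    fix v
    have g: "Ck_on k (\<lambda>x. ?g (f x) b) S" for b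
      using Suc.prems(2) by (intro Suc.IH Ck_on_SucD[OF Suc.prems(1)]) simp
    have f: "Ck_on k (\<lambda>x. ?f x v \<bullet> b) S" for b
      using Suc.prems(1)
      by (intro Ck_on_linear[OF assms(1) bounded_linear_inner_left]) simp
    have "Ck_on k (\<lambda>x. (?f x v \<bullet> b) *\<^sub>R ?g (f x) b) S" for b
      by (rule Ck_on_bilinear[OF assms(1) bounded_bilinear_scaleR f g])
    then show "Ck_on k (\<lambda>x. \<Sum>b\<in>Basis. (?f x v \<bullet> b) *\<^sub>R ?g (f x) b) S"
      by (rule Ck_on_sum[OF assms(1) finite_Basis])
  qed
qed

lemma smooth_on_frechet_derivative:
  "smooth_on f S \<Longrightarrow> smooth_on (\<lambda>x. frechet_derivative f (at x) v) S"
  unfolding smooth_on_def using Ck_on.simps(2)[of _ f S] by blast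

lemma smooth_on_differentiable: "smooth_on f S \<Longrightarrow> x \<in> S \<Longrightarrow> f differentiable (at x)"
  unfolding smooth_on_def using Ck_on.simps(2)[of _ f S] by blast

lemma smooth_on_compose:
  fixes f :: "'d::euclidean_space \<Rightarrow> 'e::euclidean_space"
    and g :: "'e \<Rightarrow> 'f::real_normed_vector"
  shows "open S \<Longrightarrow> f ` S \<subseteq> T \<Longrightarrow> smooth_on f S \<Longrightarrow> smooth_on g T \<Longrightarrow> smooth_on (\<lambda>x. g (f x)) S"
  unfolding smooth_on_def using Ck_on_compose[of S f T _ g] by blast

lemma smooth_on_cong:
  "open S \<Longrightarrow> (\<And>x. x \<in> S \<Longrightarrow> f x = g x) \<Longrightarrow> smooth_on f S \<Longrightarrow> smooth_on g S"
  unfolding smooth_on_def using Ck_on_cong[of S f g] by blast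

lemma smooth_on_scaleR:
  "open S \<Longrightarrow> smooth_on f S \<Longrightarrow> smooth_on g S \<Longrightarrow> smooth_on (\<lambda>x. f x *\<^sub>R g x) S"
  unfolding smooth_on_def using Ck_on_bilinear[OF _ bounded_bilinear_scaleR, of S _ f g] by blast

lemma smooth_on_inner_const:
  "open S \<Longrightarrow> smooth_on g S \<Longrightarrow> smooth_on (\<lambda>x. y \<bullet> g x) S"
  unfolding smooth_on_def using Ck_on_linear[OF _ bounded_linear_inner_right, of S _ g y] by blast

text \<open>The powers of \<open>1 / t\<close> make the family closed under differentiation, so that smoothness of its
  first member is an induction over the order for all members at once.\<close>

definition flat_fun :: "nat \<Rightarrow> real \<Rightarrow> real" where
  "flat_fun k t = (if t > 0 then (1 / t) ^ k * exp (- (1 / t)) else 0)"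

section \<open>A flat function on the line and bump functions on Euclidean space\<close>

lemma flat_fun_tendsto: "(flat_fun k \<longlongrightarrow> 0) (at 0)"
proof -
  \<comment> \<open>With \<open>u = 1 / t\<close> the limit from the right becomes the decay of
    \<open>exp (- u)\<close> against powers of \<open>u\<close>; from the left the function is
    constantly \<open>0\<close>.\<close>
  have "((\<lambda>u. u ^ k * exp (- u)) \<longlongrightarrow> (0::real)) at_top"
    using tendsto_power_div_exp_0[of k] by (simp add: exp_minus field_simps)
  then have "((\<lambda>t. inverse t ^ k * exp (- inverse t)) \<longlongrightarrow> (0::real)) (at_right 0)"
    by (rule filterlim_compose[OF _ filterlim_inverse_at_top_right])
  then have "(flat_fun k \<longlongrightarrow> 0) (at_right 0)"
    by (rule Lim_transform_eventually)
      (auto simp: flat_fun_def inverse_eq_divide eventually_at_filter)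
  moreover have "(flat_fun k \<longlongrightarrow> 0) (at_left 0)"
    by (rule Lim_transform_eventually[OF tendsto_const])
      (auto simp: flat_fun_def eventually_at_filter)
  ultimately show ?thesis by (simp add: filterlim_split_at)
qed

lemma flat_fun_derivative:
  "(flat_fun k has_real_derivative (flat_fun (Suc (Suc k)) x - k * flat_fun (Suc k) x)) (at x)"
proof -
  consider "x > 0" | "x < 0" | "x = 0" by linarith
  then show ?thesis
  proof cases
    case 1
    have inv: "((\<lambda>t. 1 / t) has_real_derivative - (1 / x)\<^sup>2) (at x)"
      using 1 by (auto intro!: derivative_eq_intros simp: power2_eq_square)
    have "((\<lambda>t. (1 / t) ^ k * exp (- (1 / t))) has_real_derivative
        (1 / x) ^ k * (exp (- (1 / x)) * - (- (1 / x)\<^sup>2)) +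
        real k * (- (1 / x)\<^sup>2 * (1 / x) ^ (k - Suc 0)) * exp (- (1 / x))) (at x)"
      by (rule DERIV_mult[OF DERIV_power[OF inv] DERIV_fun_exp[OF DERIV_minus[OF inv]], THEN DERIV_cong])
        simp
    also have "(1 / x) ^ k * (exp (- (1 / x)) * - (- (1 / x)\<^sup>2)) +
        real k * (- (1 / x)\<^sup>2 * (1 / x) ^ (k - Suc 0)) * exp (- (1 / x)) =
        flat_fun (Suc (Suc k)) x - k * flat_fun (Suc k) x"
      \<comment> \<open>The truncated exponent \<open>k - Suc 0\<close> forces the case split; at
        \<open>k = 0\<close> its term carries the factor \<open>0\<close>.\<close>
      using 1 by (cases k) (simp_all add: flat_fun_def power2_eq_square)
    finally have "((\<lambda>t. (1 / t) ^ k * exp (- (1 / t))) has_real_derivative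
        (flat_fun (Suc (Suc k)) x - k * flat_fun (Suc k) x)) (at x)" .
    then show ?thesis
      by (rule has_field_derivative_transform_within_open[of _ _ _ "{0<..}"])
        (use 1 in \<open>auto simp: flat_fun_def\<close>)
  next
    case 2
    have "((\<lambda>t. 0) has_real_derivative
        (flat_fun (Suc (Suc k)) x - k * flat_fun (Suc k) x)) (at x)"
      using 2 by (simp add: flat_fun_def)
    then show ?thesis
      by (rule has_field_derivative_transform_within_open[of _ _ _ "{..<0}"])
        (use 2 in \<open>auto simp: flat_fun_def\<close>)
  next
    case 3
    \<comment> \<open>The difference quotient at \<open>0\<close> is the next member of the family,
      whose limit there is \<open>0\<close>. The equation also holds for \<open>h = 0\<close>, as
      division by zero gives \<open>0\<close>.\<close>
    have "flat_fun k h / h = flat_fun (Suc k) h" "flat_fun j 0 = 0" for h j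
      by (simp_all add: flat_fun_def)
    then show ?thesis
      using flat_fun_tendsto[of "Suc k"] by (simp add: 3 DERIV_def)
  qed
qed

lemma Ck_on_flat_fun: "Ck_on k (flat_fun j) UNIV"
proof (induction k arbitrary: j)
  case 0
  show ?case
    using DERIV_isCont[OF flat_fun_derivative] by (simp add: continuous_at_imp_continuous_on)
next
  case (Suc k)
  show ?case
  proof (rule Ck_on_SucI[OF _ flat_fun_derivative[unfolded has_field_derivative_def]])
    fix v
    have "Ck_on k (\<lambda>x. v * flat_fun (Suc (Suc j)) x + (- v * real j) * flat_fun (Suc j) x) UNIV"
      by (intro Ck_on_add Ck_on_linear[OF _ bounded_linear_mult_right] Suc.IH) auto
    then show "Ck_on k (\<lambda>x. (flat_fun (Suc (Suc j)) x - real j * flat_fun (Suc j) x) * v) UNIV"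
      by (simp add: algebra_simps)
  qed auto
qed

lemma smooth_bump_function:
  fixes z0 :: "'e::euclidean_space"
  assumes "r > 0"
  obtains \<psi> :: "'e \<Rightarrow> real" where "smooth_on \<psi> UNIV" "\<psi> z0 = 1" "\<And>z. z \<notin> cball z0 r \<Longrightarrow> \<psi> z = 0"
proof -
  \<comment> \<open>The argument is positive exactly inside the open ball of radius
    \<open>r\<close>, and the constant factor normalises the value at the centre. Differences are
    written as sums with negatives to match \<open>Ck_on_add\<close>.\<close>
  define \<psi> where
    "\<psi> z = flat_fun 0 (r\<^sup>2 + - ((z + - z0) \<bullet> (z + - z0))) * inverse (flat_fun 0 (r\<^sup>2))" for z :: 'e
  have 1: "\<psi> z0 = 1" using assms by (simp add: \<psi>_def flat_fun_def)
  have 2: "\<psi> z = 0" if "z \<notin> cball z0 r" for z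
  proof -
    have "r \<le> norm (z - z0)" using that by (simp add: dist_norm norm_minus_commute)
    then have "r\<^sup>2 \<le> (z - z0) \<bullet> (z - z0)"
      using power_mono[of r "norm (z - z0)" 2] assms by (simp add: power2_norm_eq_inner)
    then show ?thesis by (simp add: \<psi>_def flat_fun_def)
  qed
  have "Ck_on k \<psi> UNIV" for k
  proof -
    have "Ck_on k (\<lambda>z. z + - z0) UNIV"
      by (rule Ck_on_add[OF open_UNIV Ck_on_ident[OF open_UNIV] Ck_on_const[OF open_UNIV]])
    from Ck_on_bilinear[OF open_UNIV bounded_bilinear_inner this this]
    have "Ck_on k (\<lambda>z. (z + - z0) \<bullet> (z + - z0)) UNIV" .
    then have "Ck_on k (\<lambda>z. - ((z + - z0) \<bullet> (z + - z0))) UNIV"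
      by (rule Ck_on_linear[OF open_UNIV bounded_linear_minus[OF bounded_linear_ident]])
    then have "Ck_on k (\<lambda>z. r\<^sup>2 + - ((z + - z0) \<bullet> (z + - z0))) UNIV"
      by (rule Ck_on_add[OF open_UNIV Ck_on_const[OF open_UNIV]])
    then have "Ck_on k (\<lambda>z. flat_fun 0 (r\<^sup>2 + - ((z + - z0) \<bullet> (z + - z0)))) UNIV"
      by (rule Ck_on_compose[OF open_UNIV subset_UNIV _ Ck_on_flat_fun])
    then show ?thesis
      unfolding \<psi>_def
      by (rule Ck_on_linear[OF open_UNIV bounded_linear_mult_left])
  qed
  then have "smooth_on \<psi> UNIV" by (simp add: smooth_on_def)
  then show ?thesis using 1 2 by (rule that)
qed

section \<open>Tangent vectors and their extensions\<close>

text \<open>Just enough structure for the linear algebra of tangent spaces. It is interpreted for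
  \<open>A\<close> and for \<open>cot_atlas A\<close>; in the second case only injectivity, open
  overlaps and differentiable transitions have to be established.\<close>

locale differentiable_atlas =
  fixes A :: "('a, 'e::euclidean_space) chart set"
  assumes inj_chart: "c \<in> A \<Longrightarrow> inj_on (snd c) (fst c)"
    and open_overlap: "c \<in> A \<Longrightarrow> d \<in> A \<Longrightarrow> open (snd c ` (fst c \<inter> fst d))"
    and transition_differentiable:
      "c \<in> A \<Longrightarrow> d \<in> A \<Longrightarrow> p \<in> fst c \<Longrightarrow> p \<in> fst d \<Longrightarrow> transition c d differentiable (at (snd c p))"
begin

lemma chart_inv_chart: "c \<in> A \<Longrightarrow> p \<in> fst c \<Longrightarrow> chart_inv c (snd c p) = p"
  by (simp add: chart_inv_def inj_chart)

lemma transition_chart: "c \<in> A \<Longrightarrow> p \<in> fst c \<Longrightarrow> transition c d (snd c p) = snd d p"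
  by (simp add: transition_def chart_inv_chart)

lemma linear_transition_derivative:
  "c \<in> A \<Longrightarrow> d \<in> A \<Longrightarrow> p \<in> fst c \<Longrightarrow> p \<in> fst d \<Longrightarrow>
    linear (frechet_derivative (transition c d) (at (snd c p)))"
  by (intro linear_frechet_derivative transition_differentiable)

lemma transition_derivative_self:
  assumes "c \<in> A" "p \<in> fst c"
  shows "frechet_derivative (transition c c) (at (snd c p)) x = x"
proof -
  have "open (snd c ` fst c)"
    using open_overlap[of c c] assms by simp
  moreover have "z = transition c c z" if "z \<in> snd c ` fst c" for z
    using that assms(1) by (auto simp: transition_chart)
  ultimately have "(transition c c has_derivative (\<lambda>x. x)) (at (snd c p))"
    using has_derivative_transform_within_open[OF has_derivative_ident] assms(2) by blast
  then show ?thesis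
    by (metis frechet_derivative_at)
qed

text \<open>The cocycle rule for Jacobians, by the chain rule. It is the reason why
  \<open>tangent_vec\<close> obeys the transformation law of \<open>tangent_space\<close>.\<close>

lemma transition_derivative_compose:
  assumes "c \<in> A" "d \<in> A" "e \<in> A" "p \<in> fst c" "p \<in> fst d" "p \<in> fst e"
  shows "frechet_derivative (transition c e) (at (snd c p)) x =
    frechet_derivative (transition d e) (at (snd d p))
      (frechet_derivative (transition c d) (at (snd c p)) x)"
proof -
  let ?O = "snd c ` (fst c \<inter> fst d) \<inter> snd c ` (fst c \<inter> fst e)"
  \<comment> \<open>Injectivity of the chart turns the intersection of the two images into the image
    of the triple overlap, where both maps can be evaluated at points of the manifold.\<close>
  have O: "?O = snd c ` (fst c \<inter> fst d \<inter> (fst c \<inter> fst e))"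
    by (rule inj_on_image_Int[OF inj_chart[OF assms(1)], symmetric]) auto
  have "frechet_derivative (transition c e) (at (snd c p)) =
      frechet_derivative (transition d e \<circ> transition c d) (at (snd c p))"
  proof (rule frechet_derivative_transform_within_open)
    show "open ?O" using assms by (intro open_Int open_overlap)
    show "snd c p \<in> ?O" using assms by auto
    show "transition c e z = (transition d e \<circ> transition c d) z" if "z \<in> ?O" for z
      using that assms unfolding O by (auto simp: transition_chart)
  qed (use assms in \<open>simp add: transition_differentiable\<close>)
  also have "\<dots> = frechet_derivative (transition d e) (at (snd d p)) \<circ>
      frechet_derivative (transition c d) (at (snd c p))"
    using frechet_derivative_compose[of "transition c d" "snd c p" "transition d e"] assms
    by (simp add: transition_differentiable transition_chart)
  finally show ?thesis by simp
qed

lemma tangent_vec_in_tangent_space: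
  "c \<in> A \<Longrightarrow> p \<in> fst c \<Longrightarrow> tangent_vec A c p x \<in> tangent_space A p"
  by (auto simp: tangent_space_def tangent_vec_def intro: transition_derivative_compose)

lemma tangent_vec_chart: "c \<in> A \<Longrightarrow> p \<in> fst c \<Longrightarrow> tangent_vec A c p x c = x"
  by (simp add: tangent_vec_def transition_derivative_self)

lemma tangent_space_transition:
  assumes "v \<in> tangent_space A p" "c \<in> A" "d \<in> A" "p \<in> fst c" "p \<in> fst d"
  shows "frechet_derivative (transition c d) (at (snd c p)) (v c) = v d"
  using assms unfolding tangent_space_def by (intro sym[of "v d"]) blast

lemma tangent_space_outside:
  "v \<in> tangent_space A p \<Longrightarrow> \<not> (c \<in> A \<and> p \<in> fst c) \<Longrightarrow> v c = 0"
  unfolding tangent_space_def by blast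

lemma tangent_spaceI:
  assumes "\<And>c. \<not> (c \<in> A \<and> p \<in> fst c) \<Longrightarrow> v c = 0"
    and "\<And>c d. c \<in> A \<Longrightarrow> d \<in> A \<Longrightarrow> p \<in> fst c \<Longrightarrow> p \<in> fst d \<Longrightarrow>
      frechet_derivative (transition c d) (at (snd c p)) (v c) = v d"
  shows "v \<in> tangent_space A p"
  unfolding tangent_space_def
  by (intro CollectI conjI allI ballI impI assms(1) assms(2)[symmetric]) blast+

lemma tangent_vec_of_components:
  "c \<in> A \<Longrightarrow> p \<in> fst c \<Longrightarrow> v \<in> tangent_space A p \<Longrightarrow> tangent_vec A c p (v c) = v"
  by (rule ext) (simp add: tangent_vec_def tangent_space_transition tangent_space_outside)

lemma tv_add_in_tangent_space:
  "v \<in> tangent_space A p \<Longrightarrow> w \<in> tangent_space A p \<Longrightarrow> tv_add v w \<in> tangent_space A p"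
  by (rule tangent_spaceI)
    (simp_all add: tv_add_def linear_add[OF linear_transition_derivative]
      tangent_space_transition tangent_space_outside)

lemma tv_scale_in_tangent_space:
  "v \<in> tangent_space A p \<Longrightarrow> tv_scale r v \<in> tangent_space A p"
  by (rule tangent_spaceI)
    (simp_all add: tv_scale_def linear_scale[OF linear_transition_derivative]
      tangent_space_transition tangent_space_outside)

lemma zero_in_tangent_space: "(\<lambda>c. 0) \<in> tangent_space A p"
  by (rule tangent_spaceI) (simp_all add: linear_0[OF linear_transition_derivative])

lemma tangent_vec_add:
  "c \<in> A \<Longrightarrow> p \<in> fst c \<Longrightarrow>
    tangent_vec A c p (x + y) = tv_add (tangent_vec A c p x) (tangent_vec A c p y)"
  by (rule ext) (auto simp: tangent_vec_def tv_add_def linear_add[OF linear_transition_derivative])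

lemma tangent_vec_scale:
  "c \<in> A \<Longrightarrow> p \<in> fst c \<Longrightarrow> tangent_vec A c p (r *\<^sub>R x) = tv_scale r (tangent_vec A c p x)"
  by (rule ext) (auto simp: tangent_vec_def tv_scale_def linear_scale[OF linear_transition_derivative])

text \<open>Addition and scaling of tangent vectors are pointwise in the chart, so evaluation at any
  \<open>c\<close> is linear. Away from the domain of \<open>c\<close> it gives the zero covector,
  which lets one formula define an extended one-form everywhere.\<close>

lemma covector_of_components:
  "(\<lambda>v. if v \<in> tangent_space A p then y \<bullet> v c else 0) \<in> cotangent_space A p"
  by (auto simp: cotangent_space_def tv_add_in_tangent_space tv_scale_in_tangent_space)
    (auto simp: tv_add_def tv_scale_def inner_add_right)

end

text \<open>These are the fibre coordinates of \<open>cot_chart\<close>, named so that they can be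
  used on the base alone.\<close>

definition covector_components ::
  "('a, real^'n) chart set \<Rightarrow> ('a, real^'n) chart \<Rightarrow> 'a \<Rightarrow> ('a, real^'n) covec \<Rightarrow> real^'n::finite" where
  "covector_components A c p \<omega> = (\<chi> i. \<omega> (tangent_vec A c p (axis i 1)))"

text \<open>Expand \<open>v\<close> in the coordinate vectors of \<open>c\<close> and use linearity.
  This turns the pairing into an inner product in whichever chart is convenient.\<close>

lemma covector_eq_inner:
  fixes A :: "('a, real^'n::finite) chart set"
  assumes "differentiable_atlas A" "c \<in> A" "p \<in> fst c"
    and "\<omega> \<in> cotangent_space A p" "v \<in> tangent_space A p"
  shows "\<omega> v = covector_components A c p \<omega> \<bullet> v c"
proof -
  interpret differentiable_atlas A by fact
  let ?F = "\<lambda>x. \<omega> (tangent_vec A c p x)"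
  have "linear ?F"
    using assms(2-4)
    by (intro linearI)
      (auto simp: cotangent_space_def tangent_vec_add tangent_vec_scale tangent_vec_in_tangent_space)
  have "\<omega> v = ?F (\<Sum>i\<in>UNIV. (v c $ i) *\<^sub>R axis i 1)"
    using assms tangent_vec_of_components
    by (simp add: basis_expansion flip: scalar_mult_eq_scaleR)
  also have "\<dots> = (\<Sum>i\<in>UNIV. v c $ i * ?F (axis i 1))"
    by (simp add: linear_sum[OF \<open>linear ?F\<close>] linear_scale[OF \<open>linear ?F\<close>])
  finally show ?thesis
    by (simp add: covector_components_def inner_vec_def mult.commute)
qed

section \<open>Charts of a smooth manifold, extension by zero and manifold bump functions\<close>

lemma smooth_manifold_chartD:
  assumes "smooth_manifold X A" "c \<in> A"
  shows "openin X (fst c)" "open (snd c ` fst c)"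
    "homeomorphic_map (subtopology X (fst c)) (top_of_set (snd c ` fst c)) (snd c)"
  using assms by (auto simp: smooth_manifold_def)

lemma smooth_manifold_inj_chart:
  assumes "smooth_manifold X A" "c \<in> A"
  shows "inj_on (snd c) (fst c)"
  using homeomorphic_imp_injective_map[OF smooth_manifold_chartD(3)[OF assms]]
    openin_subset[OF smooth_manifold_chartD(1)[OF assms]]
  by (simp add: Int_absorb1)

lemma smooth_manifold_open_image:
  assumes "smooth_manifold X A" "c \<in> A" "openin X V"
  shows "open (snd c ` (fst c \<inter> V))"
proof -
  have "openin (top_of_set (snd c ` fst c)) (snd c ` (fst c \<inter> V))"
    using homeomorphic_imp_open_map[OF smooth_manifold_chartD(3)[OF assms(1,2)]] assms(3)
    unfolding open_map_def by (simp add: openin_subtopology_Int2)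
  then show ?thesis
    using smooth_manifold_chartD(2)[OF assms(1,2)] by (rule openin_open_trans)
qed

lemma smooth_manifold_transition:
  "smooth_manifold X A \<Longrightarrow> c \<in> A \<Longrightarrow> d \<in> A \<Longrightarrow> smooth_on (transition c d) (snd c ` (fst c \<inter> fst d))"
  by (simp add: smooth_manifold_def)

lemma smooth_manifold_differentiable_atlas:
  assumes "smooth_manifold X A"
  shows "differentiable_atlas A"
proof
  fix c d assume cd: "c \<in> A" "d \<in> A"
  show "inj_on (snd c) (fst c)" using smooth_manifold_inj_chart[OF assms cd(1)] .
  show "open (snd c ` (fst c \<inter> fst d))"
    using smooth_manifold_open_image[OF assms cd(1)] smooth_manifold_chartD(1)[OF assms cd(2)] .
  show "transition c d differentiable (at (snd c p))" if "p \<in> fst c" "p \<in> fst d" for p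
    using smooth_on_differentiable[OF smooth_manifold_transition[OF assms cd]] that by blast
qed

text \<open>The set is compact, being a continuous image of a compact ball, and compact sets of a
  Hausdorff space are closed. Closedness in all of \<open>X\<close>, not merely in the chart domain,
  is what extension by zero requires.\<close>

lemma smooth_manifold_closedin_cball:
  assumes "smooth_manifold X A" "c \<in> A" "cball z r \<subseteq> snd c ` fst c"
  shows "closedin X (chart_inv c ` cball z r)"
proof -
  obtain g where g: "homeomorphic_maps (subtopology X (fst c)) (top_of_set (snd c ` fst c)) (snd c) g"
    using smooth_manifold_chartD(3)[OF assms(1,2)] by (auto simp: homeomorphic_map_maps)
  have top: "topspace (subtopology X (fst c)) = fst c"
    using openin_subset[OF smooth_manifold_chartD(1)[OF assms(1,2)]] by auto
  have "chart_inv c y = g y" if "y \<in> snd c ` fst c" for y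
    using that g smooth_manifold_inj_chart[OF assms(1,2)] top
    by (auto simp: homeomorphic_maps_def chart_inv_def)
  then have eq: "chart_inv c ` cball z r = g ` cball z r"
    using assms(3) by (intro image_cong) auto
  have "compactin (top_of_set (snd c ` fst c)) (cball z r)"
    using assms(3) by (simp add: compactin_subtopology)
  then have "compactin (subtopology X (fst c)) (g ` cball z r)"
    using g by (auto simp: homeomorphic_maps_def intro: image_compactin)
  then have "compactin X (chart_inv c ` cball z r)"
    by (simp add: eq compactin_subtopology)
  then show ?thesis
    using assms(1) by (intro compactin_imp_closedin) (simp_all add: smooth_manifold_def)
qed

text \<open>The open set \<open>V\<close> and the complement of \<open>K\<close> cover the domain of
  \<open>c\<close>: on the first piece smoothness is assumed, on the second the function vanishes.
  In applications \<open>V\<close> is the domain of the chart carrying the bump, and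
  \<open>c\<close> is any other chart.\<close>

lemma smooth_on_extend_by_zero:
  assumes X: "smooth_manifold X A" and c: "c \<in> A" and V: "openin X V"
    and K: "closedin X K" "K \<subseteq> V"
    and f: "smooth_on (\<lambda>z. f (chart_inv c z)) (snd c ` (fst c \<inter> V))"
    and zero: "\<And>q. q \<in> fst c \<Longrightarrow> q \<notin> K \<Longrightarrow> f q = 0"
  shows "smooth_on (\<lambda>z. f (chart_inv c z)) (snd c ` fst c)"
proof -
  interpret differentiable_atlas A
    using X by (rule smooth_manifold_differentiable_atlas)
  have U: "fst c \<subseteq> topspace X"
    using smooth_manifold_chartD(1)[OF X c] by (rule openin_subset)
  let ?O = "snd c ` (fst c \<inter> (topspace X - K))"
  have op: "open (snd c ` (fst c \<inter> V))" "open ?O"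
    using K(1) by (auto intro!: smooth_manifold_open_image[OF X c] V)
  have "Ck_on k (\<lambda>z. f (chart_inv c z)) (snd c ` (fst c \<inter> V) \<union> ?O)" for k
  proof (rule Ck_on_Un[OF op])
    show "Ck_on k (\<lambda>z. f (chart_inv c z)) (snd c ` (fst c \<inter> V))"
      using f by (simp add: smooth_on_def)
    show "Ck_on k (\<lambda>z. f (chart_inv c z)) ?O"
      by (rule Ck_on_cong[OF op(2) _ Ck_on_const[OF op(2)]])
        (auto simp: chart_inv_chart[OF c] zero)
  qed
  moreover have "snd c ` (fst c \<inter> V) \<union> ?O = snd c ` fst c"
    using K(2) U by blast
  ultimately show ?thesis by (simp add: smooth_on_def)
qed

lemma smooth_manifold_bump:
  assumes X: "smooth_manifold X A" and c: "c \<in> A" and p: "p \<in> fst c"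
  obtains \<psi> K where "smooth_on \<psi> UNIV" "\<psi> (snd c p) = (1::real)" "closedin X K" "K \<subseteq> fst c"
    "\<And>q. q \<in> fst c \<Longrightarrow> q \<notin> K \<Longrightarrow> \<psi> (snd c q) = 0"
proof -
  interpret differentiable_atlas A
    using X by (rule smooth_manifold_differentiable_atlas)
  obtain r where r: "r > 0" "cball (snd c p) r \<subseteq> snd c ` fst c"
    using smooth_manifold_chartD(2)[OF X c] p unfolding open_contains_cball by blast
  obtain \<psi> :: "'b \<Rightarrow> real" where \<psi>: "smooth_on \<psi> UNIV" "\<psi> (snd c p) = 1"
      "\<And>z. z \<notin> cball (snd c p) r \<Longrightarrow> \<psi> z = 0"
    using smooth_bump_function[OF r(1)] by blast
  let ?K = "chart_inv c ` cball (snd c p) r"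
  have "?K \<subseteq> fst c"
    using r(2) by (auto simp: chart_inv_def intro: inv_into_into)
  moreover have "\<psi> (snd c q) = 0" if "q \<in> fst c" "q \<notin> ?K" for q
  proof (rule \<psi>(3), rule notI)
    assume "snd c q \<in> cball (snd c p) r"
    then have "chart_inv c (snd c q) \<in> ?K" by (rule imageI)
    then show False using that by (simp add: chart_inv_chart[OF c])
  qed
  ultimately show thesis
    using that[OF \<psi>(1,2) smooth_manifold_closedin_cball[OF X c r(2)]] by blast
qed

text \<open>Keep the components of \<open>v\<close> constant in a chart around \<open>p\<close>,
  multiply by a bump function and continue by zero.\<close>

lemma tangent_vector_extends:
  fixes A :: "('a, 'e::euclidean_space) chart set"
  assumes X: "smooth_manifold X A" and p: "p \<in> carrier_of A" and v: "v \<in> tangent_space A p"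
  obtains V where "vector_field A V" "V p = v"
proof -
  interpret differentiable_atlas A
    using X by (rule smooth_manifold_differentiable_atlas)
  from p obtain c where c: "c \<in> A" and pc: "p \<in> fst c"
    unfolding carrier_of_def by blast
  obtain \<psi> K where \<psi>: "smooth_on \<psi> UNIV" "\<psi> (snd c p) = (1::real)" "closedin X K" "K \<subseteq> fst c"
      "\<And>q. q \<in> fst c \<Longrightarrow> q \<notin> K \<Longrightarrow> \<psi> (snd c q) = 0"
    by (rule smooth_manifold_bump[OF X c pc]) (rule that)
  define V where "V q = (if q \<in> fst c then tv_scale (\<psi> (snd c q)) (tangent_vec A c q (v c)) else (\<lambda>_. 0))" for q
  have "vector_field A V"
    unfolding vector_field_def
  proof (intro conjI ballI)
    show "V q \<in> tangent_space A q" for q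
      by (simp add: V_def zero_in_tangent_space tv_scale_in_tangent_space
          tangent_vec_in_tangent_space[OF c])
  next
    fix d assume d: "d \<in> A"
    let ?S = "snd d ` (fst d \<inter> fst c)"
    have S: "open ?S" using open_overlap[OF d c] .
    show "smooth_on (\<lambda>z. V (chart_inv d z) d) (snd d ` fst d)"
    proof (rule smooth_on_extend_by_zero[OF X d smooth_manifold_chartD(1)[OF X c] \<psi>(3,4)])
      show "V q d = 0" if "q \<in> fst d" "q \<notin> K" for q
        using \<psi>(5)[OF _ that(2)] by (simp add: V_def tv_scale_def)
      have t: "smooth_on (transition d c) ?S"
        by (rule smooth_manifold_transition[OF X d c])
      \<comment> \<open>In the chart \<open>d\<close> the field is the bump times the Jacobian of
        \<open>transition c d\<close> applied to the fixed vector \<open>v c\<close>; only the base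
        point varies.\<close>
      have "smooth_on (\<lambda>z. frechet_derivative (transition c d) (at (transition d c z)) (v c)) ?S"
        by (rule smooth_on_compose[OF S _ t smooth_on_frechet_derivative[OF smooth_manifold_transition[OF X c d]]])
          (auto simp: transition_chart[OF d])
      then have "smooth_on (\<lambda>z. \<psi> (transition d c z) *\<^sub>R
          frechet_derivative (transition c d) (at (transition d c z)) (v c)) ?S"
        by (rule smooth_on_scaleR[OF S smooth_on_compose[OF S subset_UNIV t \<psi>(1)]])
      then show "smooth_on (\<lambda>z. V (chart_inv d z) d) ?S"
        by (rule smooth_on_cong[OF S, rotated])
          (auto simp: V_def tv_scale_def tangent_vec_def transition_chart[OF d]
            chart_inv_chart[OF d] d)
    qed
  qed
  moreover have "V p = v"
    using pc \<psi>(2) v tangent_vec_of_components[OF c pc v] by (simp add: V_def tv_scale_def)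
  ultimately show thesis by (rule that)
qed

text \<open>The dual construction: constant covector components, cut off by a bump. The coefficients
  in a chart \<open>d\<close> pair these components with columns of the Jacobian of
  \<open>transition d c\<close>.\<close>

lemma covector_extends:
  fixes A :: "('a, real^'n::finite) chart set"
  assumes X: "smooth_manifold X A" and p: "p \<in> carrier_of A" and \<omega>: "\<omega> \<in> cotangent_space A p"
  obtains \<alpha> where "one_form A \<alpha>" "\<alpha> p = \<omega>"
proof -
  have da: "differentiable_atlas A"
    using X by (rule smooth_manifold_differentiable_atlas)
  then interpret differentiable_atlas A .
  from p obtain c where c: "c \<in> A" and pc: "p \<in> fst c"
    unfolding carrier_of_def by blast
  obtain \<psi> K where \<psi>: "smooth_on \<psi> UNIV" "\<psi> (snd c p) = (1::real)" "closedin X K" "K \<subseteq> fst c"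
      "\<And>q. q \<in> fst c \<Longrightarrow> q \<notin> K \<Longrightarrow> \<psi> (snd c q) = 0"
    by (rule smooth_manifold_bump[OF X c pc]) (rule that)
  let ?y = "covector_components A c p \<omega>"
  \<comment> \<open>The inner conditional is essential, because \<open>snd c\<close> has arbitrary
    values outside \<open>fst c\<close>.\<close>
  define \<alpha> where "\<alpha> q = (\<lambda>v. if v \<in> tangent_space A q then
    ((if q \<in> fst c then \<psi> (snd c q) else 0) *\<^sub>R ?y) \<bullet> v c else 0)" for q
  have "one_form A \<alpha>"
    unfolding one_form_def
  proof (intro conjI ballI)
    show "\<alpha> q \<in> cotangent_space A q" for q
      unfolding \<alpha>_def by (rule covector_of_components)
  next
    fix d b assume d: "d \<in> A"
    let ?S = "snd d ` (fst d \<inter> fst c)"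
    have S: "open ?S" using open_overlap[OF d c] .
    show "smooth_on (\<lambda>z. \<alpha> (chart_inv d z) (tangent_vec A d (chart_inv d z) b)) (snd d ` fst d)"
    proof (rule smooth_on_extend_by_zero[OF X d smooth_manifold_chartD(1)[OF X c] \<psi>(3,4)])
      show "\<alpha> q (tangent_vec A d q b) = 0" if "q \<in> fst d" "q \<notin> K" for q
        using \<psi>(5)[OF _ that(2)] by (simp add: \<alpha>_def)
      have t: "smooth_on (transition d c) ?S"
        by (rule smooth_manifold_transition[OF X d c])
      have "smooth_on (\<lambda>z. ?y \<bullet> frechet_derivative (transition d c) (at z) b) ?S"
        by (rule smooth_on_inner_const[OF S smooth_on_frechet_derivative[OF t]])
      then have "smooth_on (\<lambda>z. \<psi> (transition d c z) *\<^sub>R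
          (?y \<bullet> frechet_derivative (transition d c) (at z) b)) ?S"
        by (rule smooth_on_scaleR[OF S smooth_on_compose[OF S subset_UNIV t \<psi>(1)]])
      then show "smooth_on (\<lambda>z. \<alpha> (chart_inv d z) (tangent_vec A d (chart_inv d z) b)) ?S"
      proof (rule smooth_on_cong[OF S, rotated])
        fix z assume "z \<in> ?S"
        then obtain q where q: "q \<in> fst d" "q \<in> fst c" "z = snd d q" by blast
        then show "\<psi> (transition d c z) *\<^sub>R (?y \<bullet> frechet_derivative (transition d c) (at z) b) =
            \<alpha> (chart_inv d z) (tangent_vec A d (chart_inv d z) b)"
          using tangent_vec_in_tangent_space[OF d q(1)]
          by (simp add: \<alpha>_def transition_chart[OF d] chart_inv_chart[OF d])
            (simp add: tangent_vec_def c)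
      qed
    qed
  qed
  moreover have "\<alpha> p = \<omega>"
  proof
    show "\<alpha> p v = \<omega> v" for v
      using covector_eq_inner[OF da c pc \<omega>, of v] \<omega> \<psi>(2) pc
      by (auto simp: \<alpha>_def cotangent_space_def)
  qed
  ultimately show thesis by (rule that)
qed

section \<open>The cotangent bundle and the pull-back\<close>

lemma fst_cot_chart: "fst (cot_chart A c) = (SIGMA p:fst c. cotangent_space A p)"
  by (simp add: cot_chart_def)

lemma snd_cot_chart: "snd (cot_chart A c) (p, \<omega>) = (snd c p, covector_components A c p \<omega>)"
  by (simp add: cot_chart_def covector_components_def)

lemma covector_eqI:
  fixes A :: "('a, real^'n::finite) chart set"
  assumes "differentiable_atlas A" "c \<in> A" "p \<in> fst c"
    and "\<omega> \<in> cotangent_space A p" "\<eta> \<in> cotangent_space A p"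
    and "covector_components A c p \<omega> = covector_components A c p \<eta>"
  shows "\<omega> = \<eta>"
proof
  fix v show "\<omega> v = \<eta> v"
  proof (cases "v \<in> tangent_space A p")
    case True
    then show ?thesis
      using covector_eq_inner[OF assms(1-3)] assms(4-6) by metis
  next
    case False
    then show ?thesis using assms(4,5) by (simp add: cotangent_space_def)
  qed
qed

text \<open>Surjectivity of the fibre coordinates, which makes overlaps of induced charts full
  cylinders over overlaps of the base.\<close>

lemma covector_components_exists:
  fixes A :: "('a, real^'n::finite) chart set"
  assumes "differentiable_atlas A" "c \<in> A" "p \<in> fst c"
  obtains \<omega> where "\<omega> \<in> cotangent_space A p" "covector_components A c p \<omega> = y"
proof
  interpret differentiable_atlas A by fact
  let ?\<omega> = "\<lambda>v. if v \<in> tangent_space A p then y \<bullet> v c else 0"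
  show "?\<omega> \<in> cotangent_space A p" by (rule covector_of_components)
  show "covector_components A c p ?\<omega> = y"
    using assms by (simp add: covector_components_def tangent_vec_in_tangent_space
        tangent_vec_chart inner_axis vec_eq_iff)
qed

text \<open>The transition maps are written out explicitly. Their fibre part contains first
  derivatives of base transitions, so its differentiability comes from second derivatives of the
  base.\<close>

lemma cot_atlas_differentiable:
  fixes A :: "('a, real^'n::finite) chart set"
  assumes X: "smooth_manifold X A"
  shows "differentiable_atlas (cot_atlas A)"
proof
  have da: "differentiable_atlas A"
    using X by (rule smooth_manifold_differentiable_atlas)
  then interpret differentiable_atlas A .
  have inj: "inj_on (snd (cot_chart A c)) (fst (cot_chart A c))" if c: "c \<in> A" for c
  proof (rule inj_onI)
    fix a b :: "('a, 'n) cot"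
    assume ab: "a \<in> fst (cot_chart A c)" "b \<in> fst (cot_chart A c)"
      "snd (cot_chart A c) a = snd (cot_chart A c) b"
    obtain p \<omega> q \<eta> where eq: "a = (p, \<omega>)" "b = (q, \<eta>)" by (metis surj_pair)
    from ab have "p = q"
      using inj_chart[OF c] by (auto simp: eq fst_cot_chart snd_cot_chart dest: inj_onD)
    with ab show "a = b"
      using covector_eqI[OF da c, of p \<omega> \<eta>] by (auto simp: eq fst_cot_chart snd_cot_chart)
  qed
  have overlap: "snd (cot_chart A c) ` (fst (cot_chart A c) \<inter> fst (cot_chart A d)) =
      snd c ` (fst c \<inter> fst d) \<times> UNIV" if c: "c \<in> A" for c d
  proof (intro equalityI subsetI)
    fix z assume "z \<in> snd c ` (fst c \<inter> fst d) \<times> (UNIV :: (real^'n) set)"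
    then obtain p y where p: "p \<in> fst c" "p \<in> fst d" "z = (snd c p, y)" by blast
    obtain \<omega> where "\<omega> \<in> cotangent_space A p" "covector_components A c p \<omega> = y"
      using covector_components_exists[OF da c p(1)] .
    then show "z \<in> snd (cot_chart A c) ` (fst (cot_chart A c) \<inter> fst (cot_chart A d))"
      using p by (intro image_eqI[of _ _ "(p, \<omega>)"]) (auto simp: fst_cot_chart snd_cot_chart)
  qed (auto simp: fst_cot_chart snd_cot_chart)
  have op: "open (snd c ` (fst c \<inter> fst d) \<times> (UNIV :: (real^'n) set))"
    if "c \<in> A" "d \<in> A" for c d
    by (rule open_Times[OF open_overlap[OF that] open_UNIV])
  fix c' d' assume "c' \<in> cot_atlas A" "d' \<in> cot_atlas A"
  then obtain c d where c: "c \<in> A" "c' = cot_chart A c" and d: "d \<in> A" "d' = cot_chart A d"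
    unfolding cot_atlas_def by blast
  show "inj_on (snd c') (fst c')" using inj c by simp
  show "open (snd c' ` (fst c' \<inter> fst d'))" using c d overlap op by simp
  fix a assume a: "a \<in> fst c'" "a \<in> fst d'"
  let ?S = "snd c ` (fst c \<inter> fst d) \<times> (UNIV :: (real^'n) set)"
  let ?D = "\<lambda>x i. frechet_derivative (transition d c) (at (transition c d x)) (axis i (1::real))"
  \<comment> \<open>Covector components transform by the transpose of the Jacobian of the inverse transition.\<close>
  let ?T = "\<lambda>z. (transition c d (fst z), \<Sum>i\<in>UNIV. (snd z \<bullet> ?D (fst z) i) *\<^sub>R axis i (1::real))"
  have aS: "snd c' a \<in> ?S"
    using overlap[OF c(1), of d] a c(2) d(2) by blast
  have "?T differentiable (at (snd c' a))"
  proof -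
    obtain q where q: "q \<in> fst c" "q \<in> fst d" "fst (snd c' a) = snd c q"
      using aS by (auto simp: mem_Times_iff)
    have f: "fst differentiable (at z)" and s: "snd differentiable (at z)" for z :: "(real^'n) \<times> (real^'n)"
      using bounded_linear_imp_has_derivative[OF bounded_linear_fst]
        bounded_linear_imp_has_derivative[OF bounded_linear_snd]
      by (blast intro: differentiableI)+
    have T: "(\<lambda>z. transition c d (fst z)) differentiable (at (snd c' a))"
      using differentiable_compose[OF _ f] transition_differentiable[OF c(1) d(1) q(1,2)] q(3)
      by (metis)
    have D: "(\<lambda>x. frechet_derivative (transition d c) (at x) v) differentiable (at (snd d q))" for v
      using smooth_on_differentiable[OF smooth_on_frechet_derivative[OF
            smooth_manifold_transition[OF X d(1) c(1)]]] q by blast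
    have "(\<lambda>z. ?D (fst z) i) differentiable (at (snd c' a))" for i
    proof (rule differentiable_compose[OF _ T])
      show "(\<lambda>x. frechet_derivative (transition d c) (at x) (axis i 1)) differentiable
          (at (transition c d (fst (snd c' a))))"
        using D q transition_chart[OF c(1) q(1)] by simp
    qed
    then have "(\<lambda>z. (snd z \<bullet> ?D (fst z) i) *\<^sub>R axis i (1::real)) differentiable (at (snd c' a))" for i
      by (intro differentiable_scaleR differentiable_inner s differentiable_const)
    then show ?thesis
      by (intro differentiable_Pair T differentiable_sum) auto
  qed
  \<comment> \<open>The formula is compared with the actual transition only on the open set
    \<open>?S\<close>, since \<open>chart_inv\<close> is unspecified outside the image of the chart.
    Agreement there suffices for differentiability at \<open>snd c' a\<close>.\<close>
  moreover have "?T z = transition c' d' z" if "z \<in> ?S" for z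
  proof -
    from that obtain b where "b \<in> fst c'" "b \<in> fst d'" "z = snd c' b"
      unfolding overlap[OF c(1), of d, symmetric] c(2) d(2) by blast
    then obtain p \<omega> where p: "p \<in> fst c" "p \<in> fst d" "\<omega> \<in> cotangent_space A p"
      and z: "z = snd c' (p, \<omega>)"
      using c(2) d(2) by (auto simp: fst_cot_chart)
    have "(p, \<omega>) \<in> fst c'" using p c(2) by (simp add: fst_cot_chart)
    then have "transition c' d' z = snd d' (p, \<omega>)"
      using inj[OF c(1)] c(2) z by (simp add: transition_def chart_inv_def)
    \<comment> \<open>The \<open>i\<close>-th component in \<open>d\<close> is the value of
      \<open>\<omega>\<close> on a coordinate vector of \<open>d\<close>; evaluating this pairing in
      \<open>c\<close> produces a column of the Jacobian of \<open>transition d c\<close>.\<close>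
    moreover have "covector_components A c p \<omega> \<bullet> ?D (snd c p) i =
        \<omega> (tangent_vec A d p (axis i 1))" for i
      using covector_eq_inner[OF da c(1) p(1,3) tangent_vec_in_tangent_space[OF d(1) p(2)]] p c(1)
      by (simp add: transition_chart tangent_vec_def)
    then have "(\<Sum>i\<in>UNIV. (covector_components A c p \<omega> \<bullet> ?D (snd c p) i) *\<^sub>R axis i (1::real)) =
        covector_components A d p \<omega>"
      by (simp add: covector_components_def vec_eq_iff axis_def if_distrib cong: if_cong)
    ultimately show ?thesis
      using p z c d by (simp add: snd_cot_chart transition_chart)
  qed
  ultimately show "transition c' d' differentiable (at (snd c' a))"
    by (rule differentiable_transform_open[OF _ op[OF c(1) d(1)] aS])
qed

section \<open>Lifts and the pulled-back tensors\<close>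

lemma cotangent_bundle_carrier: "cotangent_bundle A = carrier_of (cot_atlas A)"
  by (auto simp: cotangent_bundle_def carrier_of_def cot_atlas_def fst_cot_chart)

lemma chart_at_fst:
  assumes "a \<in> cotangent_bundle A"
  shows "chart_at A (fst a) \<in> A" "a \<in> fst (cot_chart A (chart_at A (fst a)))"
proof -
  obtain p \<omega> where eq: "a = (p, \<omega>)" by (rule prod.exhaust)
  have ex: "\<exists>c. c \<in> A \<and> p \<in> fst c" and \<omega>: "\<omega> \<in> cotangent_space A p"
    using assms unfolding eq cotangent_bundle_def carrier_of_def by blast+
  from someI_ex[OF ex] have "chart_at A p \<in> A \<and> p \<in> fst (chart_at A p)"
    unfolding chart_at_def .
  with \<omega> show "chart_at A (fst a) \<in> A" "a \<in> fst (cot_chart A (chart_at A (fst a)))"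
    by (simp_all add: eq fst_cot_chart)
qed

text \<open>Each lift is the tangent vector with prescribed components in one induced chart, so the
  transformation law holds whatever these components are.\<close>

lemma lifts_in_tangent_space:
  fixes A :: "('a, real^'n::finite) chart set"
  assumes X: "smooth_manifold X A" and a: "a \<in> cotangent_bundle A"
  shows "horizontal_lift X A nabla a v \<in> tangent_space (cot_atlas A) a"
    "vertical_lift A a \<omega> \<in> tangent_space (cot_atlas A) a"
proof -
  interpret differentiable_atlas "cot_atlas A"
    using X by (rule cot_atlas_differentiable)
  have "cot_chart A (chart_at A (fst a)) \<in> cot_atlas A"
    using chart_at_fst(1)[OF a] by (simp add: cot_atlas_def)
  note * = tangent_vec_in_tangent_space[OF this chart_at_fst(2)[OF a]]
  show "horizontal_lift X A nabla a v \<in> tangent_space (cot_atlas A) a"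
    "vertical_lift A a \<omega> \<in> tangent_space (cot_atlas A) a"
    unfolding horizontal_lift_def vertical_lift_def Let_def by (rule *)+
qed

text \<open>Keeping the sign \<open>s\<close> as a parameter treats both tensors by a single
  bilinear expansion.\<close>

lemma pull_back_patterson_walker:
  fixes A :: "('a, real^'n::finite) chart set"
  assumes X: "smooth_manifold X A" and h: "patterson_walker X A nabla s h"
    and a: "a \<in> cotangent_bundle A"
    and v: "v \<in> tangent_space A (fst a)" and w: "w \<in> tangent_space A (fst a)"
    and \<alpha>: "\<alpha> \<in> cotangent_space A (fst a)" and \<beta>: "\<beta> \<in> cotangent_space A (fst a)"
  shows "pull_back X A nabla h a (v, \<alpha>) (w, \<beta>) = \<alpha> w + s * \<beta> v"
proof -
  interpret differentiable_atlas "cot_atlas A"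
    using X by (rule cot_atlas_differentiable)
  let ?H = "horizontal_lift X A nabla a" and ?L = "vertical_lift A a"
  let ?T = "tangent_space (cot_atlas A) a"
  have p: "fst a \<in> carrier_of A"
    using a by (auto simp: cotangent_bundle_def)
  obtain V where V: "vector_field A V" "V (fst a) = v"
    using tangent_vector_extends[OF X p v] .
  obtain W where W: "vector_field A W" "W (fst a) = w"
    using tangent_vector_extends[OF X p w] .
  obtain \<phi> where \<phi>: "one_form A \<phi>" "\<phi> (fst a) = \<alpha>"
    using covector_extends[OF X p \<alpha>] .
  obtain \<theta> where \<theta>: "one_form A \<theta>" "\<theta> (fst a) = \<beta>"
    using covector_extends[OF X p \<beta>] .
  have pw: "h a (?H (V (fst a))) (?H (W (fst a))) = 0 \<and>
      h a (?L (\<phi> (fst a))) (?L (\<theta> (fst a))) = 0 \<and>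
      h a (?L (\<phi> (fst a))) (?H (V (fst a))) = \<phi> (fst a) (V (fst a)) \<and>
      h a (?H (V (fst a))) (?L (\<phi> (fst a))) = s * \<phi> (fst a) (V (fst a))"
    if "vector_field A V" "vector_field A W" "one_form A \<phi>" "one_form A \<theta>" for V W \<phi> \<theta>
    using h that a unfolding patterson_walker_def Let_def by blast
  have lift_values: "h a (?H v) (?H w) = 0" "h a (?L \<alpha>) (?L \<beta>) = 0"
      "h a (?L \<alpha>) (?H w) = \<alpha> w" "h a (?H v) (?L \<beta>) = s * \<beta> v"
    \<comment> \<open>The defining equations pair the first form with the first field. The mixed
      values \<open>\<alpha> w\<close> and \<open>s * \<beta> v\<close> therefore come from
      instances with the two fields or the two forms exchanged.\<close>
    using pw[OF V(1) W(1) \<phi>(1) \<theta>(1)] pw[OF V(1) W(1) \<theta>(1) \<phi>(1)] pw[OF W(1) V(1) \<phi>(1) \<theta>(1)]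
    by (simp_all add: V(2) W(2) \<phi>(2) \<theta>(2))
  have h': "tensor_field_02 (cot_atlas A) h" using h by (simp add: patterson_walker_def)
  have bil: "h a (tv_add x y) z = h a x z + h a y z" "h a z (tv_add x y) = h a z x + h a z y"
    if "x \<in> ?T" "y \<in> ?T" "z \<in> ?T" for x y z
    using h' a that unfolding tensor_field_02_def cotangent_bundle_carrier by blast+
  have T: "?H x \<in> ?T" "?L \<omega> \<in> ?T" for x \<omega>
    using lifts_in_tangent_space[OF X a] by blast+
  show ?thesis
    using lift_values by (simp add: pull_back_def Phi_def bil T tv_add_in_tangent_space)
qed

theorem proposition4p1:
  fixes X :: "'a topology"
    and A :: "('a, real^'n::finite) chart set"
    and nabla :: "('a, real^'n) conn"
    and h_plus h_minus :: "('a, 'n) cot_tensor"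
  assumes "smooth_manifold X A"
    and "affine_connection A nabla"
    and "patterson_walker X A nabla 1 h_plus"
    and "patterson_walker X A nabla (- 1) h_minus"
  shows "\<forall>a\<in>cotangent_bundle A.
    \<forall>\<sigma>\<in>tangent_space A (fst a) \<times> cotangent_space A (fst a).
    \<forall>\<tau>\<in>tangent_space A (fst a) \<times> cotangent_space A (fst a).
      pull_back X A nabla h_plus a \<sigma> \<tau> = - 2 * sym_pairing \<sigma> \<tau> \<and>
      pull_back X A nabla h_minus a \<sigma> \<tau> = - 2 * skew_pairing \<sigma> \<tau>"
  \<comment> \<open>The signs \<open>1\<close> and \<open>- 1\<close> give
    \<open>\<alpha> w + \<beta> v\<close> and \<open>\<alpha> w - \<beta> v\<close>; the factor
    \<open>- 2\<close> cancels the \<open>- (1/2)\<close> in the pairings.\<close>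
  using pull_back_patterson_walker[OF assms(1,3)] pull_back_patterson_walker[OF assms(1,4)]
  by (auto simp: sym_pairing_def skew_pairing_def)

end
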